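(* Let $F$ be a supertropical semifield, $n\ge1$, and let $A\in M_n(F)$ be separable, with characteristic polynomial $f_A=\prod_{i=1}^n(\lambda+\beta_i)$, where $\beta_1,\dots,\beta_n\in\mathcal T$ are distinct. For each $i$ let $v_i$ be a (tangible) supertropical eigenvector of $A$ with supertropical eigenvalue $\beta_i$, and let $U_A$ be the $n\times n$ matrix whose $i$-th column is $v_i$. Assume that $U_A$ is nonsingular. Then $A$ is tropically conjugate to a diagonal matrix, in the sense that $$U_A^\nabla A U_A=D_A+\text{ghost},$$ where $D_A=\operatorname{diag}\{\beta_1,\dots,\beta_n\}$.
   Context: A supertropical semiring $(F,\mathcal G_0,\nu)$ is a commutative semiring $F$ with unit $\mathbb 1$ and zero $\mathbb 0$ (with $\mathbb 0 r=\mathbb 0$ for all $r$), a semiring ideal $\mathcal G_0=\mathcal G\cup\{\mathbb 0\}$ (the ghost ideal, where $\mathcal G=\mathcal G_0\setminus\{\mathbb 0\}$), and an idempotent map $\nu:F\to\mathcal G_0$, written $a^\nu=\nu(a)$, preserving addition and multiplication, given by $\nu(a)=a+a$ and equal to the identity on $\mathcal G_0$, such that $a+b=a^\nu$ if $a^\nu=b^\nu$, and $a+b\in\{a,b\}$ if $a^\nu\ne b^\nu$. $\mathcal G_0$ is totally ordered by $a^\nu\le b^\nu$ iff $a^\nu+b^\nu=b^\nu$. Tangible elements: $\mathcal T=F\setminus\mathcal G_0$; $\mathcal T_0=\mathcal T\cup\{\mathbb 0\}$. It is a supertropical semifield if $\mathcal T$ is a multiplicative group (with identity $\mathbb 1$)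 and $\nu|_{\mathcal T}:\mathcal T\to\mathcal G$ is onto. Tropical determinant: $|B|=\sum_{\pi\in S_n}b_{1,\pi(1)}\cdots b_{n,\pi(n)}$ (the empty determinant is $\mathbb 1$). $B$ is nonsingular if $|B|\in\mathcal T$. $\operatorname{adj}(B)$ is the transpose of $(b'_{i,j})$, where $b'_{i,j}$ is the tropical determinant of the matrix obtained from $B$ by deleting row $i$ and column $j$ (no signs). For $B$ nonsingular, $B^\nabla=|B|^{-1}\operatorname{adj}(B)$. The characteristic polynomial is $f_A=|\lambda I+A|$; $A$ is separable if $f_A$ splits as a product of distinct monic linear tangible factors. A tangible vector is one with all entries in $\mathcal T_0$, not all $\mathbb 0$. For vectors or matrices, $X=Y+\text{ghost}$ means $X=Y+Z$ for some $Z$ with all entries in $\mathcal G_0$. A tangible vector $v$ is a supertropical eigenvector of $A$ with supertropical eigenvalue $\beta\in\mathcal T_0$ if $Av=\beta v+\text{ghost}$. *)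

theory Defs
  imports "Jordan_Normal_Form.Determinant"
begin

text \<open>
  The ghost ideal and the ghost map are kept as explicit components of the structure, although
  the remaining laws determine both (\<open>nu a = a + a\<close> and \<open>ghost_ideal = range nu\<close>).
  The base class excludes the one-element semiring; in a semifield \<open>0 \<noteq> 1\<close> holds anyway,
  since \<open>1\<close> is tangible and \<open>0\<close> is a ghost.
\<close>

class supertropical_semiring = comm_semiring_1 +
  fixes ghost_ideal :: "'a set"
    and nu :: "'a \<Rightarrow> 'a"
  assumes zero_ghost: "0 \<in> ghost_ideal"
    and ghost_add: "a \<in> ghost_ideal \<Longrightarrow> b \<in> ghost_ideal \<Longrightarrow> a + b \<in> ghost_ideal"
    and ghost_mult: "a \<in> ghost_ideal \<Longrightarrow> r * a \<in> ghost_ideal"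
    and nu_ghost: "nu a \<in> ghost_ideal"
    and nu_idem: "nu (nu a) = nu a"
    and nu_add: "nu (a + b) = nu a + nu b"
    and nu_mult: "nu (a * b) = nu a * nu b"
    and nu_eq_double: "nu a = a + a"
    and nu_on_ghost: "a \<in> ghost_ideal \<Longrightarrow> nu a = a"
    and add_nu_eq: "nu a = nu b \<Longrightarrow> a + b = nu a"
    and add_nu_neq: "nu a \<noteq> nu b \<Longrightarrow> a + b \<in> {a, b}"

text \<open>
  The total order on the ghost ideal is a consequence of the axioms.
\<close>

definition nu_le :: "'a::supertropical_semiring \<Rightarrow> 'a \<Rightarrow> bool" where
  "nu_le a b \<longleftrightarrow> nu a + nu b = nu b"

lemma ghost_ideal_linear_order:
  "linear_order_on (ghost_ideal :: 'a::supertropical_semiring set)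
     {(a, b). a \<in> ghost_ideal \<and> b \<in> ghost_ideal \<and> nu_le a b}"
proof -
  have refl: "a + a = a" if "a \<in> ghost_ideal" for a :: 'a
    using that nu_eq_double nu_on_ghost by metis
  have total: "a + b = a \<or> a + b = b" if "a \<in> ghost_ideal" "b \<in> ghost_ideal" for a b :: 'a
    proof (cases "a = b")
    case True
    then show ?thesis using refl that by simp
  next
    case False
    then show ?thesis using add_nu_neq[of a b] that by (simp add: nu_on_ghost)
  qed
  have trans: "a + c = c" if "a + b = b" "b + c = c" for a b c :: 'a
    using that by (metis add.assoc)
  show ?thesis
    unfolding linear_order_on_def partial_order_on_def preorder_on_def refl_on_def trans_def
      antisym_def total_on_def nu_le_def
    by (auto simp: nu_on_ghost refl) (metis trans total add.commute)+
qed

definition tangibles :: "'a::supertropical_semiring set" where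
  "tangibles = - ghost_ideal"

definition tangibles0 :: "'a::supertropical_semiring set" where
  "tangibles0 = insert 0 tangibles"

class supertropical_semifield = supertropical_semiring +
  assumes one_tangible: "1 \<in> - ghost_ideal"
    and tangible_mult: "a \<in> - ghost_ideal \<Longrightarrow> b \<in> - ghost_ideal \<Longrightarrow> a * b \<in> - ghost_ideal"
    and tangible_inverse: "a \<in> - ghost_ideal \<Longrightarrow> \<exists>b \<in> - ghost_ideal. a * b = 1"
    and nu_onto: "nu ` (- ghost_ideal) = ghost_ideal - {0}"

text \<open>The inverse in the group of tangible elements; only meaningful for tangible arguments.\<close>

definition tangible_inv :: "'a::supertropical_semifield \<Rightarrow> 'a" where
  "tangible_inv a = (THE b. b \<in> tangibles \<and> a * b = 1)"

text \<open>
  The tropical determinant makes sense over any commutative semiring; this generality is needed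
  for the characteristic polynomial, whose matrix has entries in \<open>'a poly\<close>.
\<close>

definition tdet :: "'a::comm_semiring_1 mat \<Rightarrow> 'a" where
  "tdet B = (\<Sum>p \<in> {p. p permutes {0..<dim_row B}}. \<Prod>i = 0..<dim_row B. B $$ (i, p i))"

definition nonsingular :: "'a::supertropical_semifield mat \<Rightarrow> bool" where
  "nonsingular B \<longleftrightarrow> tdet B \<in> tangibles"

definition tadj :: "'a::comm_semiring_1 mat \<Rightarrow> 'a mat" where
  "tadj B = transpose_mat
     (mat (dim_row B) (dim_col B) (\<lambda>(i, j). tdet (mat_delete B i j)))"

definition nabla :: "'a::supertropical_semifield mat \<Rightarrow> 'a mat" where
  "nabla B = tangible_inv (tdet B) \<cdot>\<^sub>m tadj B"

definition tcharpoly :: "'a::comm_semiring_1 mat \<Rightarrow> 'a poly" where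
  "tcharpoly A = tdet (([:0, 1:] \<cdot>\<^sub>m 1\<^sub>m (dim_row A)) + map_mat (\<lambda>a. [:a:]) A)"

text \<open>Here \<open>[:b, 1:]\<close> is the monic linear polynomial \<open>\<lambda> + b\<close>.\<close>

definition separable_mat :: "'a::supertropical_semifield mat \<Rightarrow> bool" where
  "separable_mat A \<longleftrightarrow>
     (\<exists>B. finite B \<and> B \<subseteq> tangibles \<and> tcharpoly A = (\<Prod>b\<in>B. [:b, 1:]))"

definition tangible_vec :: "'a::supertropical_semiring vec \<Rightarrow> bool" where
  "tangible_vec v \<longleftrightarrow>
     (\<forall>i < dim_vec v. v $ i \<in> tangibles0) \<and> (\<exists>i < dim_vec v. v $ i \<noteq> 0)"

text \<open>\<open>X = Y + ghost\<close>, for vectors and for matrices.\<close>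

definition eq_plus_ghost_vec :: "'a::supertropical_semiring vec \<Rightarrow> 'a vec \<Rightarrow> bool" where
  "eq_plus_ghost_vec X Y \<longleftrightarrow>
     (\<exists>Z \<in> carrier_vec (dim_vec Y). (\<forall>i < dim_vec Z. Z $ i \<in> ghost_ideal) \<and> X = Y + Z)"

definition eq_plus_ghost_mat :: "'a::supertropical_semiring mat \<Rightarrow> 'a mat \<Rightarrow> bool" where
  "eq_plus_ghost_mat X Y \<longleftrightarrow>
     (\<exists>Z \<in> carrier_mat (dim_row Y) (dim_col Y).
        (\<forall>i < dim_row Z. \<forall>j < dim_col Z. Z $$ (i, j) \<in> ghost_ideal) \<and> X = Y + Z)"

definition supertropical_eigenvector ::
    "'a::supertropical_semiring mat \<Rightarrow> 'a vec \<Rightarrow> 'a \<Rightarrow> bool" where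
  "supertropical_eigenvector A v \<beta> \<longleftrightarrow>
     v \<in> carrier_vec (dim_row A) \<and> tangible_vec v \<and> \<beta> \<in> tangibles0 \<and>
     eq_plus_ghost_vec (A *\<^sub>v v) (\<beta> \<cdot>\<^sub>v v)"

end

theory Submission
  imports Defs
begin

text \<open>
  The hypothesis on the eigenvectors says, column by column, that \<open>A U = U D + ghost\<close> with
  \<open>D = diag(\<beta>\<^sub>1, \<dots>, \<beta>\<^sub>n)\<close>. The relation \<open>X = Y + ghost\<close> is
  transitive and is preserved by multiplication with arbitrary matrices on either side, because
  the ghosts form an ideal. Multiplying by \<open>U\<^sup>\<nabla>\<close> therefore gives
  \<open>U\<^sup>\<nabla> A U = (U\<^sup>\<nabla> U) D + ghost\<close>, and everything rests on \<open>U\<^sup>\<nabla> U = I + ghost\<close>.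

  That identity is the tropical form of Cramer's rule. By Laplace expansion along a column, the
  entry \<open>(i, j)\<close> of \<open>adj(U) U\<close> is the tropical determinant of \<open>U\<close> with column \<open>i\<close>
  replaced by column \<open>j\<close>. For \<open>i = j\<close> this is \<open>|U|\<close>, which \<open>|U|\<^sup>-\<^sup>1\<close> turns into \<open>1\<close>. For
  \<open>i \<noteq> j\<close> the matrix has two equal columns. Classically its determinant would vanish because
  the terms of \<open>\<pi>\<close> and of \<open>\<pi>\<close> followed by the transposition of \<open>i\<close> and \<open>j\<close> cancel; here these
  two terms are equal and add up to \<open>x + x\<close>, which is a ghost.
\<close>

section \<open>Tropical determinants\<close>

text \<open>
  Laplace expansion along a column holds without signs over every commutative semiring: the
  permutations that send row \<open>k\<close> to column \<open>c\<close> correspond to the permutations of the remaining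
  indices, through \<open>permutation_insert k c\<close>.
\<close>

lemma tdet_laplace_column:
  fixes B :: "'a::comm_semiring_1 mat"
  assumes B: "B \<in> carrier_mat n n" and c: "c < n"
  shows "tdet B = (\<Sum>k<n. B $$ (k, c) * tdet (mat_delete B k c))"
proof -
  obtain l where n: "n = Suc l"
    using c by (cases n) auto
  let ?N = "{0..<Suc l}" and ?Q = "{q. q permutes {0..<l}}"
  have B': "B \<in> carrier_mat (Suc l) (Suc l)" and c': "c < Suc l"
    using B c n by auto
  define g where "g p = (\<Prod>i\<in>?N. B $$ (i, p i))" for p
  have expansion: "g (permutation_insert k c q) =
      B $$ (k, c) * (\<Prod>i = 0..<l. mat_delete B k c $$ (i, q i))"
    if k: "k < Suc l" and q: "q permutes {0..<l}" for k q
  proof -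
    let ?p = "permutation_insert k c q"
    have "g ?p = B $$ (k, ?p k) * (\<Prod>i\<in>?N - {k}. B $$ (i, ?p i))"
      unfolding g_def using k by (intro prod.remove) auto
    also have "(\<Prod>i\<in>?N - {k}. B $$ (i, ?p i)) =
        (\<Prod>i = 0..<l. B $$ (insert_index k i, ?p (insert_index k i)))"
      by (simp add: insert_index_image[OF k, symmetric] prod.reindex[OF insert_index_inj_on])
    also have "\<dots> = (\<Prod>i = 0..<l. mat_delete B k c $$ (i, q i))"
    proof (rule prod.cong[OF refl])
      fix i assume i: "i \<in> {0..<l}"
      then have "q i < l"
        using permutes_in_image[OF q] by auto
      moreover have "?p (insert_index k i) = insert_index c (q i)"
        by (simp add: permutation_insert_expand insert_index_def)
      ultimately show "B $$ (insert_index k i, ?p (insert_index k i)) =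
          mat_delete B k c $$ (i, q i)"
        using mat_delete_index[OF B' k c'] i by simp
    qed
    finally show ?thesis by simp
  qed
  have "tdet B = sum g {p. p permutes ?N}"
    using B' by (simp add: tdet_def g_def)
  also have "\<dots> = (\<Sum>k\<in>?N. sum g {p. p permutes ?N \<and> p k = c})"
  proof -
    have "sum g (\<Union>k\<in>?N. {p. p permutes ?N \<and> p k = c}) =
        (\<Sum>k\<in>?N. sum g {p. p permutes ?N \<and> p k = c})"
    proof (rule sum.UNION_disjoint)
      show "\<forall>k\<in>?N. finite {p. p permutes ?N \<and> p k = c}"
        using finite_permutations[of ?N] by simp
      show "\<forall>k\<in>?N. \<forall>k'\<in>?N. k \<noteq> k' \<longrightarrow>
          {p. p permutes ?N \<and> p k = c} \<inter> {p. p permutes ?N \<and> p k' = c} = {}"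
        using c' by (intro ballI impI permutation_disjoint_dom) auto
    qed simp
    then show ?thesis
      using permutation_split_ran[of c ?N] c' by simp
  qed
  also have "\<dots> = (\<Sum>k\<in>?N. B $$ (k, c) * tdet (mat_delete B k c))"
  proof (rule sum.cong[OF refl])
    fix k assume "k \<in> ?N"
    then have k: "k < Suc l" by simp
    have "sum g {p. p permutes ?N \<and> p k = c} = (\<Sum>q\<in>?Q. g (permutation_insert k c q))"
      by (simp add: permutation_fix[OF k c'] sum.reindex[OF permutation_insert_inj_on[OF k c']])
    also have "\<dots> = B $$ (k, c) * tdet (mat_delete B k c)"
      using B' by (simp add: expansion[OF k] tdet_def sum_distrib_left)
    finally show "sum g {p. p permutes ?N \<and> p k = c} = B $$ (k, c) * tdet (mat_delete B k c)" .
  qed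
  finally show ?thesis
    by (simp add: n atLeast0LessThan)
qed

lemma tadj_carrier:
  assumes "B \<in> carrier_mat n n"
  shows "tadj B \<in> carrier_mat n n"
  using assms by (simp add: tadj_def)

text \<open>
  Replacing column \<open>i\<close> does not affect the minors that avoid this column, so the scalar product
  defining the entry on the left is the Laplace expansion of the modified matrix along column
  \<open>i\<close>.
\<close>

lemma tadj_mult_entry:
  fixes B :: "'a::comm_semiring_1 mat"
  assumes B: "B \<in> carrier_mat n n" and i: "i < n" and j: "j < n"
  shows "(tadj B * B) $$ (i, j) =
    tdet (mat n n (\<lambda>(k, c). B $$ (k, if c = i then j else c)))" (is "_ = tdet ?C")
proof -
  have minors: "mat_delete ?C k i = mat_delete B k i" if "k < n" for k
    unfolding mat_delete_def using B that by (intro eq_matI) auto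
  have "(tadj B * B) $$ (i, j) = (\<Sum>k<n. tdet (mat_delete B k i) * B $$ (k, j))"
    using B i j by (auto simp: tadj_def scalar_prod_def atLeast0LessThan intro!: sum.cong)
  also have "\<dots> = (\<Sum>k<n. ?C $$ (k, i) * tdet (mat_delete ?C k i))"
    using i by (intro sum.cong) (auto simp: minors mult.commute)
  also have "\<dots> = tdet ?C"
    using i by (intro tdet_laplace_column[symmetric]) auto
  finally show ?thesis .
qed

text \<open>
  Composing with the transposition of \<open>c\<close> and \<open>d\<close> is a bijection from the even to the odd
  permutations that preserves the terms of the determinant, so the odd half of the sum equals the
  even half, and the determinant has the form \<open>x + x\<close>.
\<close>

lemma tdet_equal_columns_ghost:
  fixes B :: "'a::supertropical_semiring mat"
  assumes B: "B \<in> carrier_mat n n" and c: "c < n" and d: "d < n" and "c \<noteq> d"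
    and eq: "\<And>k. k < n \<Longrightarrow> B $$ (k, c) = B $$ (k, d)"
  shows "tdet B \<in> ghost_ideal"
proof -
  let ?N = "{0..<n}" and ?t = "transpose c d"
  let ?E = "{p. p permutes ?N \<and> evenperm p}" and ?O = "{p. p permutes ?N \<and> \<not> evenperm p}"
  define g where "g p = (\<Prod>i\<in>?N. B $$ (i, p i))" for p
  have t: "?t permutes ?N"
    using c d by (simp add: permutes_swap_id)
  have perm: "?t \<circ> p permutes ?N" if "p permutes ?N" for p
    using that t by (rule permutes_compose)
  have parity: "evenperm (?t \<circ> p) \<longleftrightarrow> \<not> evenperm p" if "p permutes ?N" for p
    using evenperm_comp[OF permutation_swap_id permutes_imp_permutation[OF _ that]] \<open>c \<noteq> d\<close>
    by (simp add: evenperm_swap)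
  have g: "g (?t \<circ> p) = g p" if "p permutes ?N" for p
    unfolding g_def by (intro prod.cong) (auto simp: eq transpose_def)
  have "sum g ?E = sum g ?O"
    by (rule sum.reindex_bij_witness[where i = "\<lambda>p. ?t \<circ> p" and j = "\<lambda>p. ?t \<circ> p"])
      (auto simp: perm parity g simp flip: comp_assoc)
  moreover have "tdet B = sum g (?E \<union> ?O)"
    using B by (auto simp: tdet_def g_def intro!: sum.cong)
  moreover have "sum g (?E \<union> ?O) = sum g ?E + sum g ?O"
    using finite_permutations[of ?N] by (intro sum.union_disjoint) auto
  ultimately show ?thesis
    using nu_ghost[of "sum g ?E"] by (simp add: nu_eq_double)
qed

section \<open>Equality of matrices up to ghosts\<close>

lemma eq_plus_ghost_mat_iff:
  fixes X Y :: "'a::supertropical_semiring mat"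
  assumes X: "X \<in> carrier_mat m n" and Y: "Y \<in> carrier_mat m n"
  shows "eq_plus_ghost_mat X Y \<longleftrightarrow>
    (\<forall>i<m. \<forall>j<n. \<exists>z\<in>ghost_ideal. X $$ (i, j) = Y $$ (i, j) + z)" (is "_ \<longleftrightarrow> ?R")
proof
  assume "eq_plus_ghost_mat X Y"
  then show ?R
    using Y unfolding eq_plus_ghost_mat_def by fastforce
next
  assume ?R
  then obtain z where z: "\<And>i j. i < m \<Longrightarrow> j < n \<Longrightarrow>
      z i j \<in> ghost_ideal \<and> X $$ (i, j) = Y $$ (i, j) + z i j"
    by metis
  have "X = Y + mat m n (\<lambda>(i, j). z i j)"
    using X Y z by (intro eq_matI) auto
  then show "eq_plus_ghost_mat X Y"
    unfolding eq_plus_ghost_mat_def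
    using Y z by (intro bexI[of _ "mat m n (\<lambda>(i, j). z i j)"]) auto
qed

lemma sum_ghost:
  fixes f :: "'b \<Rightarrow> 'a::supertropical_semiring"
  assumes "\<And>x. x \<in> S \<Longrightarrow> f x \<in> ghost_ideal"
  shows "sum f S \<in> ghost_ideal"
  using assms by (induction S rule: infinite_finite_induct) (auto simp: zero_ghost ghost_add)

lemma eq_plus_ghost_mat_trans:
  fixes X Y Z :: "'a::supertropical_semiring mat"
  assumes "X \<in> carrier_mat m n" "Y \<in> carrier_mat m n" "Z \<in> carrier_mat m n"
    and "eq_plus_ghost_mat X Y" "eq_plus_ghost_mat Y Z"
  shows "eq_plus_ghost_mat X Z"
proof -
  have "\<exists>z\<in>ghost_ideal. X $$ (i, j) = Z $$ (i, j) + z" if ij: "i < m" "j < n" for i j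
  proof -
    obtain x where "x \<in> ghost_ideal" "X $$ (i, j) = Y $$ (i, j) + x"
      using assms ij by (auto simp: eq_plus_ghost_mat_iff[of X m n])
    moreover obtain y where "y \<in> ghost_ideal" "Y $$ (i, j) = Z $$ (i, j) + y"
      using assms ij by (auto simp: eq_plus_ghost_mat_iff[of Y m n])
    ultimately show ?thesis
      by (intro bexI[of _ "y + x"]) (simp_all add: add.assoc ghost_add)
  qed
  then show ?thesis
    using assms by (simp add: eq_plus_ghost_mat_iff[of _ m n])
qed

lemma ghost_mat_mult_left:
  fixes P Z :: "'a::supertropical_semiring mat"
  assumes "P \<in> carrier_mat l m" "Z \<in> carrier_mat m n"
    and "\<And>i j. i < m \<Longrightarrow> j < n \<Longrightarrow> Z $$ (i, j) \<in> ghost_ideal"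
    and "i < l" "j < n"
  shows "(P * Z) $$ (i, j) \<in> ghost_ideal"
  using assms by (auto simp: scalar_prod_def intro!: sum_ghost ghost_mult)

lemma ghost_mat_mult_right:
  fixes P Z :: "'a::supertropical_semiring mat"
  assumes "Z \<in> carrier_mat l m" "P \<in> carrier_mat m n"
    and "\<And>i j. i < l \<Longrightarrow> j < m \<Longrightarrow> Z $$ (i, j) \<in> ghost_ideal"
    and "i < l" "j < n"
  shows "(Z * P) $$ (i, j) \<in> ghost_ideal"
proof -
  have "Z $$ (i, k) * P $$ (k, j) \<in> ghost_ideal" if "k < m" for k
    using ghost_mult[OF assms(3)[OF assms(4) that]] by (simp add: mult.commute)
  then show ?thesis
    using assms by (auto simp: scalar_prod_def intro!: sum_ghost)
qed

lemma eq_plus_ghost_mat_mult_left: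
  fixes P X Y :: "'a::supertropical_semiring mat"
  assumes P: "P \<in> carrier_mat l m" and Y: "Y \<in> carrier_mat m n"
    and "eq_plus_ghost_mat X Y"
  shows "eq_plus_ghost_mat (P * X) (P * Y)"
proof -
  obtain Z where Z: "Z \<in> carrier_mat m n" and X: "X = Y + Z"
    and ghost: "\<And>i j. i < m \<Longrightarrow> j < n \<Longrightarrow> Z $$ (i, j) \<in> ghost_ideal"
    using assms(3) Y unfolding eq_plus_ghost_mat_def by auto
  have "P * X = P * Y + P * Z"
    unfolding X using P Y Z by (rule mult_add_distrib_mat)
  then show ?thesis
    unfolding eq_plus_ghost_mat_def using P Y Z ghost_mat_mult_left[OF P Z ghost]
    by (intro bexI[of _ "P * Z"]) auto
qed

lemma eq_plus_ghost_mat_mult_right: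
  fixes P X Y :: "'a::supertropical_semiring mat"
  assumes Y: "Y \<in> carrier_mat l m" and P: "P \<in> carrier_mat m n"
    and "eq_plus_ghost_mat X Y"
  shows "eq_plus_ghost_mat (X * P) (Y * P)"
proof -
  obtain Z where Z: "Z \<in> carrier_mat l m" and X: "X = Y + Z"
    and ghost: "\<And>i j. i < l \<Longrightarrow> j < m \<Longrightarrow> Z $$ (i, j) \<in> ghost_ideal"
    using assms(3) Y unfolding eq_plus_ghost_mat_def by auto
  have "X * P = Y * P + Z * P"
    unfolding X using Y Z P by (rule add_mult_distrib_mat)
  then show ?thesis
    unfolding eq_plus_ghost_mat_def using P Y Z ghost_mat_mult_right[OF Z P ghost]
    by (intro bexI[of _ "Z * P"]) auto
qed

section \<open>The pseudo-inverse of a nonsingular matrix\<close>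

lemma tangible_inv_mult:
  fixes a :: "'a::supertropical_semifield"
  assumes "a \<in> tangibles"
  shows "tangible_inv a * a = 1"
proof -
  obtain b where b: "b \<in> tangibles" "a * b = 1"
    using tangible_inverse[of a] assms by (auto simp: tangibles_def)
  \<comment> \<open>inverses in a commutative monoid are unique\<close>
  have "c = b" if "a * c = 1" for c
    using that b by (metis mult.assoc mult.commute mult_1)
  with b have "tangible_inv a = b"
    unfolding tangible_inv_def by (intro the_equality) blast+
  with b show ?thesis by (simp add: mult.commute)
qed

lemma nabla_carrier:
  assumes "U \<in> carrier_mat n n"
  shows "nabla U \<in> carrier_mat n n"
  using tadj_carrier[OF assms] by (simp add: nabla_def)

text \<open>
  The tropical Cramer rule: off the diagonal, \<open>adj(U) U\<close> contains determinants of matrices with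
  two equal columns, which are ghosts; on the diagonal the extra ghost is \<open>0\<close>.
\<close>

lemma nabla_mult_self:
  fixes U :: "'a::supertropical_semifield mat"
  assumes U: "U \<in> carrier_mat n n" and ns: "nonsingular U"
  shows "eq_plus_ghost_mat (nabla U * U) (1\<^sub>m n)"
proof -
  have carrier: "nabla U * U \<in> carrier_mat n n"
    using nabla_carrier[OF U] U by (rule mult_carrier_mat)
  have entry: "(nabla U * U) $$ (i, j) = tangible_inv (tdet U) * (tadj U * U) $$ (i, j)"
    if "i < n" "j < n" for i j
    using that U tadj_carrier[OF U] by (simp add: nabla_def)
  have "\<exists>z\<in>ghost_ideal. (nabla U * U) $$ (i, j) = 1\<^sub>m n $$ (i, j) + z"
    if i: "i < n" and j: "j < n" for i j
  proof (cases "i = j")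
    case True
    have "mat n n (\<lambda>(k, c). U $$ (k, if c = i then i else c)) = U"
      using U by (intro eq_matI) auto
    then have "(nabla U * U) $$ (i, j) = 1"
      using True i entry tadj_mult_entry[OF U i i] tangible_inv_mult ns
      by (simp add: nonsingular_def)
    then show ?thesis
      using True i zero_ghost by (intro bexI[of _ 0]) auto
  next
    case False
    have "(tadj U * U) $$ (i, j) \<in> ghost_ideal"
      unfolding tadj_mult_entry[OF U i j]
      using False i j by (intro tdet_equal_columns_ghost[of _ n i j]) auto
    then show ?thesis
      using False i j by (auto simp: entry ghost_mult)
  qed
  then show ?thesis
    using carrier by (simp add: eq_plus_ghost_mat_iff[of _ n n])
qed

section \<open>Diagonalization\<close>

theorem corollary7p14:
  fixes A U :: "'a::supertropical_semifield mat"
    and \<beta> :: "nat \<Rightarrow> 'a"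
    and v :: "nat \<Rightarrow> 'a vec"
    and n :: nat
  assumes "n \<ge> 1"
    and "A \<in> carrier_mat n n"
    and "separable_mat A"
    and "tcharpoly A = (\<Prod>i<n. [:\<beta> i, 1:])"
    and "\<And>i. i < n \<Longrightarrow> \<beta> i \<in> tangibles"
    and "inj_on \<beta> {..<n}"
    and "\<And>i. i < n \<Longrightarrow> supertropical_eigenvector A (v i) (\<beta> i)"
    and "U = mat_of_cols n (map v [0..<n])"
    and "nonsingular U"
  shows "eq_plus_ghost_mat (nabla U * A * U) (mat_diag n \<beta>)"
proof -
  let ?D = "mat_diag n \<beta>"
  have A: "A \<in> carrier_mat n n" by fact
  have U: "U \<in> carrier_mat n n"
    using assms(8) by (auto simp: mat_of_cols_def)
  have N: "nabla U \<in> carrier_mat n n"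
    using U by (rule nabla_carrier)
  have v: "v j \<in> carrier_vec n" if "j < n" for j
    using assms(7)[OF that] A by (simp add: supertropical_eigenvector_def)
  have col: "col U j = v j" if "j < n" for j
    using v that assms(8) by simp
  have "eq_plus_ghost_mat (A * U) (U * ?D)"
  proof -
    have "\<exists>z\<in>ghost_ideal. (A * U) $$ (i, j) = (U * ?D) $$ (i, j) + z"
      if i: "i < n" and j: "j < n" for i j
    proof -
      have "(A * U) $$ (i, j) = (A *\<^sub>v v j) $ i"
        using A U i j by (simp add: col)
      moreover have "(U * ?D) $$ (i, j) = (\<beta> j \<cdot>\<^sub>v v j) $ i"
        using U v[OF j] i j
        by (simp add: mat_diag_mult_right[OF U] mult.commute flip: col)
      moreover obtain Z where "Z \<in> carrier_vec n" "\<forall>i<n. Z $ i \<in> ghost_ideal"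
          "A *\<^sub>v v j = \<beta> j \<cdot>\<^sub>v v j + Z"
        using assms(7)[OF j] v[OF j]
        by (auto simp: supertropical_eigenvector_def eq_plus_ghost_vec_def)
      ultimately show ?thesis
        using i v[OF j] by auto
    qed
    then show ?thesis
      using A U by (simp add: eq_plus_ghost_mat_iff[of _ n n])
  qed
  then have "eq_plus_ghost_mat (nabla U * (A * U)) (nabla U * (U * ?D))"
    using N U by (intro eq_plus_ghost_mat_mult_left) auto
  moreover have "nabla U * (A * U) = nabla U * A * U"
    using N A U by (simp add: assoc_mult_mat)
  moreover have "nabla U * (U * ?D) = nabla U * U * ?D"
    using N U by (simp add: assoc_mult_mat[of _ n n _ n _ n])
  ultimately have "eq_plus_ghost_mat (nabla U * A * U) (nabla U * U * ?D)"
    by simp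
  moreover have "eq_plus_ghost_mat (nabla U * U * ?D) ?D"
    using eq_plus_ghost_mat_mult_right[OF _ _ nabla_mult_self[OF U assms(9)], of n n ?D n]
    by (simp add: left_mult_one_mat[of _ n n])
  ultimately show ?thesis
    using N A U by - (rule eq_plus_ghost_mat_trans[of _ n n "nabla U * U * ?D"],
      auto intro!: mult_carrier_mat[of _ n n])
qed

end
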